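(* Suppose $\Sigma$ is a finite set with $2\le|\Sigma|<\infty$. For every loss function $\ell:X\times\Sigma\to\mathbb{R}$ and every $r\ge 0$, the KL-DRO predictor $\hat c_{\mathrm{KL},r}$ is uniformly feasible at rate $r$, i.e. $$\sup_{P\in\mathcal{P}(\Sigma)}\ \limsup_{N\to\infty}\frac1N\log\mathrm{Prob}\left[\exists x\in X \text{ such that } c(x,P)>\hat c_{\mathrm{KL},r}(x,P_N)\right]\le -r .$$
   Context: $X\subseteq\mathbb{R}^m$ is a nonempty set of decisions. $\Sigma$ is a finite set equipped with all subsets as $\sigma$-algebra, and $\mathcal{P}(\Sigma)=\{P\in\mathbb{R}^{|\Sigma|}:\sum_{i\in\Sigma}P(i)=1,\ P(i)\ge0\}$ with the topology induced from $\mathbb{R}^{|\Sigma|}$. The loss $\ell:X\times\Sigma\to\mathbb{R}$ is bounded below, and $c(x,P):=\mathbb{E}_P[\ell(x,\xi)]$. For $P\in\mathcal{P}(\Sigma)$, $\xi_1,\xi_2,\dots$ are i.i.d. samples from $P$, $P_N:=\frac1N\sum_{i=1}^N\delta_{\xi_i}$ is the empirical distribution, and $\mathrm{Prob}$ is the probability under this sampling; $\log 0=-\infty$. KL divergence (convention on the order of arguments): $D_{\mathrm{KL}}(P',P)=\sum_{\xi\in\Sigma}P'(\xi)\log\frac{P'(\xi)}{P(\xi)}$ if $P'\ll P$, with $0\log 0=0$, and $D_{\mathrm{KL}}(P',P)=+\infty$ otherwise. KL-DRO predictor: $\hat c_{\mathrm{KL},r}(x,\hat P):=\sup\{c(x,P):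 P\in\mathcal{P}(\Sigma),\ D_{\mathrm{KL}}(\hat P,P)\le r\}$. *)

theory Defs
  imports "HOL-Probability.Probability"
begin

text \<open>
  The finite set \<open>\<Sigma>\<close> is the universe of a finite type \<open>'s\<close>, and a point of \<open>\<P>(\<Sigma>)\<close> is an \<open>'s pmf\<close>.
\<close>

definition cost :: "('x \<Rightarrow> 's::finite \<Rightarrow> real) \<Rightarrow> 'x \<Rightarrow> 's pmf \<Rightarrow> real" where
  "cost loss x P = measure_pmf.expectation P (loss x)"

text \<open>
  The library's \<open>KL_divergence\<close> is real-valued and so has no value \<open>+\<infinity>\<close> when absolute continuity
  fails.  The premise \<open>absolutely_continuous P P'\<close> says \<open>P' \<lless> P\<close>; in the sum, terms with
  \<open>pmf P' \<xi> = 0\<close> vanish, which is the convention \<open>0 log 0 = 0\<close>.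
\<close>
definition D_KL :: "'s::finite pmf \<Rightarrow> 's pmf \<Rightarrow> ereal" where
  "D_KL P' P =
    (if absolutely_continuous (measure_pmf P) (measure_pmf P')
     then ereal (\<Sum>\<xi>\<in>UNIV. pmf P' \<xi> * ln (pmf P' \<xi> / pmf P \<xi>))
     else \<infinity>)"

lemma D_KL_refl: "D_KL P P = 0"
proof -
  have "pmf P \<xi> * ln (pmf P \<xi> / pmf P \<xi>) = 0" for \<xi>
    by (cases "pmf P \<xi> = 0") auto
  then have "(\<Sum>\<xi>\<in>UNIV. pmf P \<xi> * ln (pmf P \<xi> / pmf P \<xi>)) = 0"
    by (intro sum.neutral ballI)
  then show ?thesis
    unfolding D_KL_def absolutely_continuous_def by (simp only: order_refl if_True zero_ereal_def)
qed

text \<open>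
  The supremum is taken in \<open>ereal\<close>; for \<open>r \<ge> 0\<close> the set is nonempty and bounded, so the value
  is the real supremum.
\<close>
definition KL_DRO :: "('x \<Rightarrow> 's::finite \<Rightarrow> real) \<Rightarrow> real \<Rightarrow> 'x \<Rightarrow> 's pmf \<Rightarrow> ereal" where
  "KL_DRO loss r x Phat = (SUP P \<in> {P. D_KL Phat P \<le> ereal r}. ereal (cost loss x P))"

lemma KL_DRO_finite:
  assumes "0 \<le> r"
  shows "\<bar>KL_DRO loss r x Phat\<bar> \<noteq> \<infinity>"
proof -
  let ?M = "Max (range (loss x))"
  have "cost loss x P \<le> ?M" for P
  proof -
    have "cost loss x P \<le> measure_pmf.expectation P (\<lambda>_. ?M)"
      unfolding cost_def by (intro integral_mono integrable_measure_pmf_finite) auto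
    then show ?thesis by simp
  qed
  then have "KL_DRO loss r x Phat \<le> ereal ?M"
    unfolding KL_DRO_def by (intro SUP_least) simp
  moreover have "ereal (cost loss x Phat) \<le> KL_DRO loss r x Phat"
    unfolding KL_DRO_def using assms by (intro SUP_upper) (simp add: D_KL_refl)
  ultimately show ?thesis by (cases "KL_DRO loss r x Phat") auto
qed

definition iid_samples :: "'s pmf \<Rightarrow> (nat \<Rightarrow> 's) measure" where
  "iid_samples P = PiM UNIV (\<lambda>_. measure_pmf P)"

text \<open>
  Samples are indexed from \<open>0\<close>.  The value for \<open>N = 0\<close> is unspecified and does not affect limits.
\<close>
definition empirical :: "nat \<Rightarrow> (nat \<Rightarrow> 's) \<Rightarrow> 's pmf" where
  "empirical N \<xi> = map_pmf \<xi> (pmf_of_set {..<N})"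

lemma pmf_empirical:
  assumes "N > 0"
  shows "pmf (empirical N \<xi>) s = (1 / real N) * (\<Sum>i<N. indicator {s} (\<xi> i))"
proof -
  have "pmf (empirical N \<xi>) s = measure (pmf_of_set {..<N}) (\<xi> -` {s})"
    by (simp add: empirical_def pmf_map)
  also have "\<dots> = real (card ({..<N} \<inter> \<xi> -` {s})) / real N"
    using assms by (subst measure_pmf_of_set) auto
  also have "real (card ({..<N} \<inter> \<xi> -` {s})) = (\<Sum>i<N. indicator {s} (\<xi> i))"
    by (simp add: indicator_def sum.If_cases vimage_def Int_def)
  finally show ?thesis by simp
qed

lemma sets_empirical_event:
  fixes P :: "'s::finite pmf"
  assumes "N > 0"
  shows "{\<xi> \<in> space (iid_samples P). Q (empirical N \<xi>)} \<in> sets (iid_samples P)"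
proof -
  have emp: "empirical N \<xi> = empirical N (\<lambda>i. xs ! i)"
    if "\<forall>i<N. \<xi> i = xs ! i" for \<xi> :: "nat \<Rightarrow> 's" and xs
    unfolding empirical_def using that assms
    by (intro map_pmf_cong refl) (simp add: lessThan_empty_iff)
  have cyl: "{\<xi> \<in> space (iid_samples P). \<forall>i<N. \<xi> i = xs ! i} \<in> sets (iid_samples P)" for xs
    unfolding iid_samples_def by measurable
  have "{\<xi> \<in> space (iid_samples P). Q (empirical N \<xi>)} =
    (\<Union>xs\<in>{xs. Q (empirical N (\<lambda>i. xs ! i))}.
      {\<xi> \<in> space (iid_samples P). \<forall>i<N. \<xi> i = xs ! i})" (is "?L = ?R")
  proof (intro equalityI subsetI)
    fix \<xi> assume "\<xi> \<in> ?L"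
    then have *: "\<xi> \<in> space (iid_samples P)" "Q (empirical N \<xi>)" by simp_all
    have **: "\<forall>i<N. \<xi> i = map \<xi> [0..<N] ! i" by simp
    from *(2) have "Q (empirical N (\<lambda>i. map \<xi> [0..<N] ! i))"
      by (subst (asm) emp[OF **])
    with *(1) ** show "\<xi> \<in> ?R" by blast
  next
    fix \<xi> assume "\<xi> \<in> ?R"
    then obtain xs where xs: "Q (empirical N (\<lambda>i. xs ! i))" "\<forall>i<N. \<xi> i = xs ! i"
      and *: "\<xi> \<in> space (iid_samples P)" by blast
    have "Q (empirical N \<xi>)"
      by (subst emp[OF xs(2)]) (rule xs(1))
    with * show "\<xi> \<in> ?L" by simp
  qed
  also have "\<dots> \<in> sets (iid_samples P)"
    by (intro sets.countable_UN'' cyl) auto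
  finally show ?thesis .
qed

definition ln_ext :: "real \<Rightarrow> ereal" where
  "ln_ext p = (if p = 0 then -\<infinity> else ereal (ln p))"

text \<open>
  Since samples are drawn from the finite set \<open>\<Sigma>\<close>, the event below is measurable for every
  \<open>X\<close> and \<open>N > 0\<close> by \<open>sets_empirical_event\<close>.
\<close>
definition uniformly_feasible ::
    "'x set \<Rightarrow> ('x \<Rightarrow> 's::finite \<Rightarrow> real) \<Rightarrow> ('x \<Rightarrow> 's pmf \<Rightarrow> ereal) \<Rightarrow> real \<Rightarrow> bool" where
  "uniformly_feasible X loss chat r \<longleftrightarrow>
    (SUP P. limsup (\<lambda>N. ereal (1 / real N) *
      ln_ext (\<P>(\<xi> in iid_samples P. \<exists>x\<in>X. ereal (cost loss x P) > chat x (empirical N \<xi>)))))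
    \<le> ereal (- r)"

end

theory Submission
  imports Defs "HOL-Real_Asymp.Real_Asymp"
begin

text \<open>
  If the predictor at \<open>P\<^sub>N\<close> underestimates the cost under \<open>P\<close> for some decision, then \<open>P\<close> lies
  outside the divergence ball, so \<open>D\<^sub>K\<^sub>L(P\<^sub>N, P) > r\<close> regardless of the decision.  The upper bound
  in Sanov's theorem, by the method of types, finishes the proof: a sample with empirical
  distribution \<open>Q\<close> has \<open>P\<close>-probability \<open>exp (- N D\<^sub>K\<^sub>L(Q, P))\<close> times its \<open>Q\<close>-probability, the
  \<open>Q\<close>-probabilities of all samples add up to 1, and there are at most \<open>(N + 1)^|\<Sigma>|\<close> different \<open>Q\<close>.
\<close>

lemma empirical_cong:
  assumes "N > 0" "\<And>i. i < N \<Longrightarrow> \<xi> i = \<eta> i"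
  shows "empirical N \<xi> = empirical N \<eta>"
  unfolding empirical_def using assms
  by (intro map_pmf_cong refl) (simp add: lessThan_empty_iff)

text \<open>Applied with \<open>g\<close> the log-likelihood ratio, this turns N times a divergence
  into a sum over the samples.\<close>

lemma sum_empirical:
  fixes \<xi> :: "nat \<Rightarrow> 's::finite" and g :: "'s \<Rightarrow> real"
  assumes "N > 0"
  shows "(\<Sum>s\<in>UNIV. pmf (empirical N \<xi>) s * g s) = (\<Sum>i<N. g (\<xi> i)) / real N"
proof -
  have "(\<Sum>s\<in>UNIV. pmf (empirical N \<xi>) s * g s) = measure_pmf.expectation (empirical N \<xi>) g"
    by (subst integral_measure_pmf[of UNIV]) auto
  also have "\<dots> = (\<Sum>i<N. g (\<xi> i)) / real N"
    using assms unfolding empirical_def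
    by (simp add: integral_pmf_of_set lessThan_empty_iff)
  finally show ?thesis .
qed

lemma pmf_empirical_pos:
  assumes "i < N"
  shows "pmf (empirical N \<xi>) (\<xi> i) > 0"
proof -
  have "\<xi> i \<in> set_pmf (empirical N \<xi>)"
    using assms unfolding empirical_def by (simp add: lessThan_empty_iff)
  then show ?thesis by (simp add: pmf_positive)
qed

text \<open>Selects the finite branch of \<open>D_KL\<close>: the support of the empirical
  distribution is exactly the set of sampled values.\<close>

lemma absolutely_continuous_empirical:
  assumes "N > 0" "\<And>i. i < N \<Longrightarrow> pmf P (\<xi> i) \<noteq> 0"
  shows "absolutely_continuous (measure_pmf P) (measure_pmf (empirical N \<xi>))"
proof -
  have "set_pmf (empirical N \<xi>) = \<xi> ` {..<N}"
    using assms(1) unfolding empirical_def by (simp add: lessThan_empty_iff)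
  then have "set_pmf (empirical N \<xi>) \<subseteq> set_pmf P"
    using assms(2) by (auto simp: set_pmf_iff)
  then show ?thesis
    unfolding absolutely_continuous_def null_sets_def
    by (auto simp: measure_pmf.emeasure_eq_measure measure_pmf_zero_iff)
qed

text \<open>Change of measure: N times the divergence is the logarithm of the ratio between the
  likelihoods of the sample under \<open>empirical N \<xi>\<close> and under
  \<open>P\<close>.\<close>

lemma prod_pmf_le_exp_D_KL:
  fixes P :: "'s::finite pmf"
  assumes N: "N > 0" and D: "D_KL (empirical N \<xi>) P > ereal r"
  shows "(\<Prod>i<N. pmf P (\<xi> i)) \<le> exp (- (real N * r)) * (\<Prod>i<N. pmf (empirical N \<xi>) (\<xi> i))"
proof (cases "\<exists>i<N. pmf P (\<xi> i) = 0")
  case True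
  then have "(\<Prod>i<N. pmf P (\<xi> i)) = 0" by auto
  moreover have "0 \<le> exp (- (real N * r)) * (\<Prod>i<N. pmf (empirical N \<xi>) (\<xi> i))"
    by (intro mult_nonneg_nonneg prod_nonneg) auto
  ultimately show ?thesis by (simp only:)
next
  case False
  let ?Q = "empirical N \<xi>"
  let ?g = "\<lambda>s. ln (pmf ?Q s / pmf P s)"
  have P: "pmf P (\<xi> i) > 0" if "i < N" for i
    using False that by (auto simp: set_pmf_iff intro: pmf_positive)
  have Q: "pmf ?Q (\<xi> i) > 0" if "i < N" for i
    using that by (rule pmf_empirical_pos)
  have "D_KL ?Q P = ereal ((\<Sum>i<N. ?g (\<xi> i)) / real N)"
    unfolding D_KL_def sum_empirical[OF N]
    using absolutely_continuous_empirical[OF N, of P \<xi>] False by auto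
  with D N have "real N * r \<le> (\<Sum>i<N. ?g (\<xi> i))"
    by (simp add: field_simps)
  then have "exp (real N * r) \<le> exp (\<Sum>i<N. ?g (\<xi> i))" by simp
  also have "\<dots> = (\<Prod>i<N. pmf ?Q (\<xi> i) / pmf P (\<xi> i))"
    using P Q by (simp add: exp_sum)
  also have "\<dots> = (\<Prod>i<N. pmf ?Q (\<xi> i)) / (\<Prod>i<N. pmf P (\<xi> i))"
    by (rule prod_dividef)
  finally have "exp (real N * r) * (\<Prod>i<N. pmf P (\<xi> i)) \<le> (\<Prod>i<N. pmf ?Q (\<xi> i))"
    by (subst (asm) pos_le_divide_eq) (auto intro: prod_pos P)
  then show ?thesis by (simp add: exp_minus field_simps)
qed

text \<open>Expand the N-th power of the total mass of \<open>Q\<close> into a sum over words of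
  length N.\<close>

lemma sum_prod_pmf_eq_1:
  fixes Q :: "'s::finite pmf"
  shows "(\<Sum>f\<in>Pi\<^sub>E {..<N::nat} (\<lambda>_. UNIV). \<Prod>i<N. pmf Q (f i)) = 1"
proof -
  have "(\<Sum>s\<in>UNIV. pmf Q s) = 1"
    by (rule sum_pmf_eq_1) auto
  then show ?thesis
    using prod_sum_PiE[of "{..<N}" "\<lambda>_. UNIV" "\<lambda>_. pmf Q"] by simp
qed

text \<open>Every mass is one of the N + 1 fractions k / N, and a distribution is determined by its
  masses at the points of the alphabet.\<close>

lemma card_empirical_le:
  fixes S :: "(nat \<Rightarrow> 's::finite) set"
  assumes N: "N > 0"
  shows "card (empirical N ` S) \<le> (N + 1) ^ CARD('s)"
proof -
  let ?B = "(\<lambda>k. real k / real N) ` {..N}"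
  let ?T = "Pi\<^sub>E (UNIV :: 's set) (\<lambda>_. ?B)"
  have mem: "pmf (empirical N \<xi>) \<in> ?T" for \<xi> :: "nat \<Rightarrow> 's"
  proof (rule PiE_I)
    fix s :: 's
    let ?k = "card {i\<in>{..<N}. \<xi> i = s}"
    have "(\<Sum>i<N. indicator {s} (\<xi> i)) = real ?k"
      by (simp add: indicator_def sum.If_cases Int_def)
    then have "pmf (empirical N \<xi>) s = real ?k / real N"
      using pmf_empirical[OF N, of \<xi> s] by simp
    moreover have "?k \<le> card {..<N}" by (intro card_mono) auto
    ultimately show "pmf (empirical N \<xi>) s \<in> ?B" by auto
  qed simp
  have fin: "finite ?T" by (intro finite_PiE) auto
  have "card (empirical N ` S) \<le> card ?T"
    using mem by (intro card_inj_on_le[of pmf] fin) (auto intro!: inj_onI simp: pmf_eq_iff)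
  also have "\<dots> = card ?B ^ CARD('s)" by (simp add: card_PiE)
  also have "\<dots> \<le> (N + 1) ^ CARD('s)"
    using card_image_le[of "{..N}" "\<lambda>k. real k / real N"] by (intro power_mono) auto
  finally show ?thesis .
qed

lemma prob_space_iid_samples: "prob_space (iid_samples P)"
  unfolding iid_samples_def by (intro prob_space_PiM measure_pmf.prob_space_axioms)

lemma measure_iid_samples_cylinder:
  "measure (iid_samples P) {\<xi> \<in> space (iid_samples P). \<forall>i<N. \<xi> i = f i} = (\<Prod>i<N. pmf P (f i))"
proof -
  interpret product_prob_space "\<lambda>_::nat. measure_pmf P" UNIV
    by (rule product_prob_spaceI) (rule measure_pmf.prob_space_axioms)
  have "emeasure (Pi\<^sub>M UNIV (\<lambda>_. measure_pmf P))
      {\<xi> \<in> space (Pi\<^sub>M UNIV (\<lambda>_. measure_pmf P)). \<forall>i\<in>{..<N}. \<xi> i \<in> {f i}}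
      = (\<Prod>i<N. emeasure (measure_pmf P) {f i})"
    by (rule emeasure_PiM_Collect) simp_all
  also have "\<dots> = ennreal (\<Prod>i<N. pmf P (f i))"
    by (simp only: emeasure_pmf_single prod_ennreal pmf_nonneg)
  finally show ?thesis
    unfolding iid_samples_def
    by (intro measure_eq_emeasure_eq_ennreal prod_nonneg ballI pmf_nonneg)
      (simp only: lessThan_iff Ball_def singleton_iff)
qed

lemma Sanov_upper_bound:
  fixes P :: "'s::finite pmf"
  assumes N: "N > 0"
  shows "\<P>(\<xi> in iid_samples P. D_KL (empirical N \<xi>) P > ereal r)
    \<le> (real N + 1) ^ CARD('s) * exp (- (real N * r))"
proof -
  interpret prob_space "iid_samples P" by (rule prob_space_iid_samples)
  let ?S = "Pi\<^sub>E {..<N} (\<lambda>_. UNIV :: 's set)"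
  let ?F = "{f \<in> ?S. D_KL (empirical N f) P > ereal r}"
  let ?C = "\<lambda>f. {\<xi> \<in> space (iid_samples P). \<forall>i<N. \<xi> i = f i}"
  let ?w = "\<lambda>Q f. \<Prod>i<N. pmf Q (f i)"
  have S: "finite ?S" by (intro finite_PiE) auto
  then have F: "finite ?F" by (rule rev_finite_subset) blast
  have C: "?C f \<in> events" for f unfolding iid_samples_def by measurable
  \<comment> \<open>Only the first N samples matter, so finitely many cylinders cover the event; the
    word of a sample is its restriction to these indices.\<close>
  have "{\<xi> \<in> space (iid_samples P). D_KL (empirical N \<xi>) P > ereal r} \<subseteq> (\<Union>f\<in>?F. ?C f)"
  proof
    fix \<xi> assume \<xi>: "\<xi> \<in> {\<xi> \<in> space (iid_samples P). D_KL (empirical N \<xi>) P > ereal r}"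
    have "empirical N (restrict \<xi> {..<N}) = empirical N \<xi>"
      using N by (intro empirical_cong) auto
    with \<xi> have "restrict \<xi> {..<N} \<in> ?F" "\<xi> \<in> ?C (restrict \<xi> {..<N})" by auto
    then show "\<xi> \<in> (\<Union>f\<in>?F. ?C f)" by blast
  qed
  then have "\<P>(\<xi> in iid_samples P. D_KL (empirical N \<xi>) P > ereal r) \<le> prob (\<Union>f\<in>?F. ?C f)"
    by (rule finite_measure_mono) (rule sets.finite_UN[OF F C])
  also have "\<dots> \<le> (\<Sum>f\<in>?F. prob (?C f))"
    by (rule finite_measure_subadditive_finite[OF F]) (use C in blast)
  also have "\<dots> = (\<Sum>f\<in>?F. ?w P f)"
    by (simp only: measure_iid_samples_cylinder)
  also have "\<dots> \<le> (\<Sum>f\<in>?F. exp (- (real N * r)) * ?w (empirical N f) f)"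
    by (intro sum_mono prod_pmf_le_exp_D_KL N) auto
  \<comment> \<open>Adding the nonnegative terms of all other types makes \<open>Q\<close>
    independent of \<open>f\<close>, so that the sums can be exchanged.\<close>
  also have "\<dots> \<le> (\<Sum>f\<in>?F. exp (- (real N * r)) * (\<Sum>Q\<in>empirical N ` ?S. ?w Q f))"
  proof (intro sum_mono mult_left_mono)
    fix f assume "f \<in> ?F"
    then show "?w (empirical N f) f \<le> (\<Sum>Q\<in>empirical N ` ?S. ?w Q f)"
      using S by (intro member_le_sum[where f = "\<lambda>Q. ?w Q f"]) (simp_all add: prod_nonneg)
  qed simp
  \<comment> \<open>Passing to all words lets each type contribute its total mass 1.\<close>
  also have "\<dots> \<le> (\<Sum>f\<in>?S. exp (- (real N * r)) * (\<Sum>Q\<in>empirical N ` ?S. ?w Q f))"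
    by (rule sum_mono2[OF S]) (simp_all add: sum_nonneg prod_nonneg Collect_subset)
  also have "\<dots> = exp (- (real N * r)) * (\<Sum>Q\<in>empirical N ` ?S. \<Sum>f\<in>?S. ?w Q f)"
    by (subst sum.swap) (simp add: sum_distrib_left)
  also have "\<dots> = exp (- (real N * r)) * real (card (empirical N ` ?S))"
    by (simp add: sum_prod_pmf_eq_1)
  also have "\<dots> \<le> exp (- (real N * r)) * real ((N + 1) ^ CARD('s))"
    using card_empirical_le[OF N, of ?S] by (intro mult_left_mono of_nat_mono) auto
  finally show ?thesis by (simp add: mult.commute add.commute)
qed

text \<open>Otherwise \<open>P\<close> would compete in the supremum that defines the
  predictor.\<close>

lemma D_KL_gt_if_underestimated:
  assumes "ereal (cost loss x P) > KL_DRO loss r x Q"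
  shows "D_KL Q P > ereal r"
proof (rule ccontr)
  assume "\<not> D_KL Q P > ereal r"
  then have "ereal (cost loss x P) \<le> KL_DRO loss r x Q"
    unfolding KL_DRO_def by (intro SUP_upper) auto
  with assms show False by simp
qed

lemma ln_ext_le_ln:
  assumes "0 \<le> p" "p \<le> b" "0 < b"
  shows "ln_ext p \<le> ereal (ln b)"
  using assms by (auto simp: ln_ext_def)

text \<open>The polynomial factor costs only k ln(N + 1) / N in the exponent, which tends to
  0.\<close>

lemma limsup_ln_ext_le:
  assumes "\<And>N. N > 0 \<Longrightarrow> 0 \<le> p N"
    and "\<And>N. N > 0 \<Longrightarrow> p N \<le> (real N + 1) ^ k * exp (- (real N * r))"
  shows "limsup (\<lambda>N. ereal (1 / real N) * ln_ext (p N)) \<le> ereal (- r)"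
proof -
  let ?u = "\<lambda>N. 1 / real N * (real k * ln (real N + 1) - real N * r)"
  have "limsup (\<lambda>N. ereal (1 / real N) * ln_ext (p N)) \<le> limsup (\<lambda>N. ereal (?u N))"
  proof (rule Limsup_mono, rule eventually_mono[OF eventually_gt_at_top[of 0]])
    fix N :: nat assume N: "0 < N"
    have "ln_ext (p N) \<le> ereal (ln ((real N + 1) ^ k * exp (- (real N * r))))"
      by (intro ln_ext_le_ln assms N mult_pos_pos zero_less_power) auto
    also have "\<dots> = ereal (real k * ln (real N + 1) - real N * r)"
      by (simp add: ln_mult ln_realpow)
    finally have "ereal (1 / real N) * ln_ext (p N)
        \<le> ereal (1 / real N) * ereal (real k * ln (real N + 1) - real N * r)"
      by (intro ereal_mult_left_mono) auto
    then show "ereal (1 / real N) * ln_ext (p N) \<le> ereal (?u N)" by simp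
  qed
  also have "?u \<longlonglongrightarrow> - r" by real_asymp
  then have "limsup (\<lambda>N. ereal (?u N)) = ereal (- r)"
    by (intro lim_imp_Limsup) auto
  finally show ?thesis .
qed

theorem theorem4p1:
  fixes X :: "(real ^ 'm) set"
    and loss :: "real ^ 'm \<Rightarrow> 's::finite \<Rightarrow> real"
    and r :: real
  assumes "X \<noteq> {}"
    and "2 \<le> CARD('s)"
    and "\<exists>b. \<forall>x\<in>X. \<forall>\<xi>. b \<le> loss x \<xi>"
    and "0 \<le> r"
  shows "uniformly_feasible X loss (KL_DRO loss r) r"
  unfolding uniformly_feasible_def
proof (intro SUP_least limsup_ln_ext_le)
  fix P :: "'s pmf" and N :: nat
  assume N: "N > 0"
  interpret prob_space "iid_samples P" by (rule prob_space_iid_samples)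
  \<comment> \<open>The larger event does not mention \<open>x\<close>, so no union bound over
    \<open>X\<close> arises.\<close>
  have "\<P>(\<xi> in iid_samples P. \<exists>x\<in>X. ereal (cost loss x P) > KL_DRO loss r x (empirical N \<xi>))
      \<le> \<P>(\<xi> in iid_samples P. D_KL (empirical N \<xi>) P > ereal r)"
    by (rule finite_measure_mono[OF _ sets_empirical_event[OF N]])
      (blast dest: D_KL_gt_if_underestimated)
  also have "\<dots> \<le> (real N + 1) ^ CARD('s) * exp (- (real N * r))"
    by (rule Sanov_upper_bound[OF N])
  finally show "\<P>(\<xi> in iid_samples P. \<exists>x\<in>X. ereal (cost loss x P) > KL_DRO loss r x (empirical N \<xi>))
      \<le> (real N + 1) ^ CARD('s) * exp (- (real N * r))" .
qed (rule measure_nonneg)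

end
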